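(* Let $\Omega\subsetneq\mathcal{X}$ be a complete Kobayashi hyperbolic domain in a complex manifold $\mathcal{X}$, with $\overline\Omega^{\mathrm{End}}$ sequentially compact. Suppose there exists a continuous surjective map $F:\overline\Omega^{\mathsf{k}}\to\overline\Omega^{\mathrm{End}}$ such that $F\circ i_{\mathsf{k}}=i_\Omega$ on $\Omega$, where $i_\Omega:\Omega\to\overline\Omega^{\mathrm{End}}$ is the inclusion. Then every geodesic ray $\gamma:[0,\infty)\to\Omega$ of $(\Omega,\mathsf{k}_\Omega)$ lands in $\overline\Omega^{\mathrm{End}}$, i.e. $\lim_{t\to\infty}\gamma(t)$ exists in $\overline\Omega^{\mathrm{End}}$ and is a point of $\partial\overline\Omega^{\mathrm{End}}$.
   Context: $\mathsf{k}_\Omega$ is the Kobayashi distance of $\Omega$; $\Omega$ is complete Kobayashi hyperbolic if $\mathsf{k}_\Omega$ is a genuine distance and $(\Omega,\mathsf{k}_\Omega)$ is complete. A domain is a nonempty connected open set; $\overline\Omega$ is the closure of $\Omega$ in $\mathcal{X}$. A geodesic ray is a map $\gamma:[0,\infty)\to\Omega$ with $\mathsf{k}_\Omega(\gamma(s),\gamma(t))=|s-t|$ for all $s,t$. End compactification: let $(K_j)_{j\ge1}$ be an exhaustion of $\overline\Omega$ by compact sets with $K_j\subset\mathrm{int}(K_{j+1})$. An end is a sequence $(F_j)_{j\ge1}$ where $F_j$ is a connected component of $\overline\Omega\setminus K_j$ and $F_{j+1}\subset F_j$. With $\mathcal{E}$ the set of ends, $\overline\Omega^{\mathrm{End}}=\overline\Omega\sqcup\mathcal{E}$.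 A neighbourhood basis at $x\in\overline\Omega$ is given by the sets $U\cap\overline\Omega$, $U$ a neighbourhood of $x$ in $\mathcal{X}$; at an end $e=(F_j)$ it is given by $\widehat F_j=F_j\sqcup\{(G_\nu)\in\mathcal{E}: G_\nu=F_\nu,\ \nu=1,\dots,j\}$, $j\ge1$. This is a first-countable Hausdorff topology independent of the exhaustion. $\partial\overline\Omega^{\mathrm{End}}=\overline\Omega^{\mathrm{End}}\setminus\Omega$. Metric compactification of $(\Omega,\mathsf{k}_\Omega)$: let $C(\Omega)$ be the real-valued continuous functions on $\Omega$ with the topology of local uniform convergence, $C_*(\Omega)$ its quotient by the constant functions with the quotient topology, and $i_{\mathsf{k}}:\Omega\to C_*(\Omega)$, $i_{\mathsf{k}}(x)=[\mathsf{k}_\Omega(x,\cdot)]$. Then $\overline\Omega^{\mathsf{k}}$ is the closure of $i_{\mathsf{k}}(\Omega)$ in $C_*(\Omega)$. *)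

theory Defs
  imports "HOL-Analysis.Analysis"
begin

section \<open>Complex manifolds\<close>

definition holomorphic_vec_on ::
    "(complex ^ 'n \<Rightarrow> complex ^ 'm) \<Rightarrow> (complex ^ 'n) set \<Rightarrow> bool" where
  "holomorphic_vec_on f S \<longleftrightarrow>
     (\<forall>z\<in>S. \<exists>D. (f has_derivative D) (at z) \<and> (\<forall>c v. D (c *s v) = c *s D v))"

type_synonym ('a, 'n) chart = "'a set \<times> ('a \<Rightarrow> complex ^ 'n)"

definition complex_manifold :: "'a topology \<Rightarrow> ('a, 'n::finite) chart set \<Rightarrow> bool" where
  "complex_manifold X \<A> \<longleftrightarrow>
     Hausdorff_space X \<and> second_countable X \<and>
     topspace X = (\<Union>(U, \<phi>)\<in>\<A>. U) \<and>
     (\<forall>(U, \<phi>)\<in>\<A>. openin X U \<and> open (\<phi> ` U) \<and>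
        homeomorphic_map (subtopology X U) (top_of_set (\<phi> ` U)) \<phi>) \<and>
     (\<forall>(U, \<phi>)\<in>\<A>. \<forall>(V, \<psi>)\<in>\<A>.
        holomorphic_vec_on (\<psi> \<circ> inv_into U \<phi>) (\<phi> ` (U \<inter> V)))"

definition domain_in :: "'a topology \<Rightarrow> 'a set \<Rightarrow> bool" where
  "domain_in X \<Omega> \<longleftrightarrow> \<Omega> \<noteq> {} \<and> openin X \<Omega> \<and> connectedin X \<Omega>"


section \<open>The Kobayashi distance\<close>

abbreviation unit_disc :: "complex set" where
  "unit_disc \<equiv> ball 0 1"

text \<open>Normalised to have curvature \<open>- 4\<close>; the other usual normalisation differs by a factor 2.\<close>
definition poincare_dist :: "complex \<Rightarrow> complex \<Rightarrow> real" where
  "poincare_dist z w = artanh (cmod ((z - w) / (1 - cnj w * z)))"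

definition holomorphic_discs ::
    "'a topology \<Rightarrow> ('a, 'n::finite) chart set \<Rightarrow> 'a set \<Rightarrow> (complex \<Rightarrow> 'a) set" where
  "holomorphic_discs X \<A> \<Omega> =
     {f. continuous_map (top_of_set unit_disc) (subtopology X \<Omega>) f \<and>
         (\<forall>(U, \<phi>)\<in>\<A>. \<forall>i. (\<lambda>\<zeta>. \<phi> (f \<zeta>) $ i) holomorphic_on {\<zeta> \<in> unit_disc. f \<zeta> \<in> U})}"

text \<open>Lengths of chains of holomorphic discs joining \<open>x = p 0\<close> to \<open>y = p (Suc n)\<close>.\<close>
definition disc_chain_lengths ::
    "'a topology \<Rightarrow> ('a, 'n::finite) chart set \<Rightarrow> 'a set \<Rightarrow> 'a \<Rightarrow> 'a \<Rightarrow> real set" where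
  "disc_chain_lengths X \<A> \<Omega> x y =
     {(\<Sum>j\<le>n. poincare_dist (\<zeta> j) (\<omega> j)) | n p f \<zeta> \<omega>.
        p 0 = x \<and> p (Suc n) = y \<and>
        (\<forall>j\<le>n. f j \<in> holomorphic_discs X \<A> \<Omega> \<and> \<zeta> j \<in> unit_disc \<and> \<omega> j \<in> unit_disc \<and>
           f j (\<zeta> j) = p j \<and> f j (\<omega> j) = p (Suc j))}"

text \<open>The value \<open>0\<close> off \<open>\<Omega> \<times> \<Omega>\<close> is a dummy: the locale \<open>Metric_space\<close> asks for nonnegativity and
  symmetry of the distance on the whole type. For a domain \<open>\<Omega>\<close> and \<open>x, y \<in> \<Omega>\<close> the set of lengths is
  nonempty and bounded below by \<open>0\<close>, so that \<open>Inf\<close> is the genuine infimum.\<close>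
definition kobayashi_dist ::
    "'a topology \<Rightarrow> ('a, 'n::finite) chart set \<Rightarrow> 'a set \<Rightarrow> 'a \<Rightarrow> 'a \<Rightarrow> real" where
  "kobayashi_dist X \<A> \<Omega> x y =
     (if x \<in> \<Omega> \<and> y \<in> \<Omega> then Inf (disc_chain_lengths X \<A> \<Omega> x y) else 0)"

definition complete_kobayashi_hyperbolic ::
    "'a topology \<Rightarrow> ('a, 'n::finite) chart set \<Rightarrow> 'a set \<Rightarrow> bool" where
  "complete_kobayashi_hyperbolic X \<A> \<Omega> \<longleftrightarrow>
     Metric_space \<Omega> (kobayashi_dist X \<A> \<Omega>) \<and>
     Metric_space.mcomplete \<Omega> (kobayashi_dist X \<A> \<Omega>)"

definition geodesic_ray :: "'a set \<Rightarrow> ('a \<Rightarrow> 'a \<Rightarrow> real) \<Rightarrow> (real \<Rightarrow> 'a) \<Rightarrow> bool" where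
  "geodesic_ray \<Omega> d \<gamma> \<longleftrightarrow>
     (\<forall>t\<ge>0. \<gamma> t \<in> \<Omega>) \<and> (\<forall>s\<ge>0. \<forall>t\<ge>0. d (\<gamma> s) (\<gamma> t) = \<bar>s - t\<bar>)"


section \<open>The end compactification\<close>

definition compact_exhaustion :: "'a topology \<Rightarrow> (nat \<Rightarrow> 'a set) \<Rightarrow> bool" where
  "compact_exhaustion Y K \<longleftrightarrow>
     (\<forall>j. compactin Y (K j)) \<and> (\<forall>j. K j \<subseteq> Y interior_of K (Suc j)) \<and> (\<Union>j. K j) = topspace Y"

text \<open>Here \<open>Y\<close> is the closure of the domain, as a space; sequences are indexed from \<open>0\<close>.\<close>
definition ends :: "'a topology \<Rightarrow> (nat \<Rightarrow> 'a set) \<Rightarrow> (nat \<Rightarrow> 'a set) set" where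
  "ends Y K =
     {F. \<forall>j. F j \<in> connected_components_of (subtopology Y (topspace Y - K j)) \<and> F (Suc j) \<subseteq> F j}"

definition end_nbhd ::
    "'a topology \<Rightarrow> (nat \<Rightarrow> 'a set) \<Rightarrow> (nat \<Rightarrow> 'a set) \<Rightarrow> nat \<Rightarrow> ('a + (nat \<Rightarrow> 'a set)) set" where
  "end_nbhd Y K F j = Inl ` F j \<union> Inr ` {G \<in> ends Y K. \<forall>\<nu>\<le>j. G \<nu> = F \<nu>}"

definition end_space :: "'a topology \<Rightarrow> (nat \<Rightarrow> 'a set) \<Rightarrow> ('a + (nat \<Rightarrow> 'a set)) set" where
  "end_space Y K = Inl ` topspace Y \<union> Inr ` ends Y K"

text \<open>A set is open iff it contains a basic neighbourhood of each of its points.\<close>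
definition end_open ::
    "'a topology \<Rightarrow> (nat \<Rightarrow> 'a set) \<Rightarrow> ('a + (nat \<Rightarrow> 'a set)) set \<Rightarrow> bool" where
  "end_open Y K W \<longleftrightarrow>
     W \<subseteq> end_space Y K \<and>
     (\<forall>x. Inl x \<in> W \<longrightarrow> (\<exists>U. openin Y U \<and> x \<in> U \<and> Inl ` U \<subseteq> W)) \<and>
     (\<forall>F. Inr F \<in> W \<longrightarrow> (\<exists>j. end_nbhd Y K F j \<subseteq> W))"

definition end_topology ::
    "'a topology \<Rightarrow> (nat \<Rightarrow> 'a set) \<Rightarrow> ('a + (nat \<Rightarrow> 'a set)) topology" where
  "end_topology Y K = topology (end_open Y K)"

lemma end_nbhd_mono:
  assumes "F \<in> ends Y K" "i \<le> j"
  shows "end_nbhd Y K F j \<subseteq> end_nbhd Y K F i"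
proof -
  have "F (Suc n) \<subseteq> F n" for n using assms(1) by (simp add: ends_def)
  then have "F j \<subseteq> F i" using lift_Suc_antimono_le[of F i j] assms(2) by blast
  moreover have "\<forall>\<nu>\<le>i. G \<nu> = F \<nu>" if "\<forall>\<nu>\<le>j. G \<nu> = F \<nu>" for G
    using that assms(2) by (meson order_trans)
  ultimately show ?thesis unfolding end_nbhd_def by blast
qed

lemma istopology_end_open: "istopology (end_open Y K)"
  unfolding istopology_def
proof (intro conjI allI impI)
  fix S T assume S: "end_open Y K S" and T: "end_open Y K T"
  show "end_open Y K (S \<inter> T)"
    unfolding end_open_def
  proof (intro conjI allI impI)
    show "S \<inter> T \<subseteq> end_space Y K" using S by (auto simp: end_open_def)
  next
    fix x assume x: "Inl x \<in> S \<inter> T"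
    obtain U where U: "openin Y U" "x \<in> U" "Inl ` U \<subseteq> S"
      using S x unfolding end_open_def by (meson IntD1)
    obtain V where V: "openin Y V" "x \<in> V" "Inl ` V \<subseteq> T"
      using T x unfolding end_open_def by (meson IntD2)
    show "\<exists>U. openin Y U \<and> x \<in> U \<and> Inl ` U \<subseteq> S \<inter> T"
    proof (intro exI conjI)
      show "openin Y (U \<inter> V)" using U V by (simp add: openin_Int)
      show "x \<in> U \<inter> V" using U V by simp
      show "Inl ` (U \<inter> V) \<subseteq> S \<inter> T" using U V by fast
    qed
  next
    fix F assume F: "Inr F \<in> S \<inter> T"
    then have E: "F \<in> ends Y K" using S by (auto simp: end_open_def end_space_def)
    obtain i where "end_nbhd Y K F i \<subseteq> S" using S F unfolding end_open_def by (meson IntD1)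
    moreover obtain j where "end_nbhd Y K F j \<subseteq> T" using T F unfolding end_open_def by (meson IntD2)
    ultimately show "\<exists>j. end_nbhd Y K F j \<subseteq> S \<inter> T"
      using end_nbhd_mono[OF E, of i "max i j"] end_nbhd_mono[OF E, of j "max i j"]
      by (meson Int_greatest max.cobounded1 max.cobounded2 subset_trans)
  qed
next
  fix \<K> assume A: "\<forall>S\<in>\<K>. end_open Y K S"
  show "end_open Y K (\<Union>\<K>)"
    unfolding end_open_def
  proof (intro conjI allI impI)
    show "\<Union>\<K> \<subseteq> end_space Y K" using A by (auto simp: end_open_def)
  next
    fix x assume "Inl x \<in> \<Union>\<K>"
    then obtain S where S: "S \<in> \<K>" "Inl x \<in> S" by blast
    with A obtain U where "openin Y U" "x \<in> U" "Inl ` U \<subseteq> S" unfolding end_open_def by meson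
    with S show "\<exists>U. openin Y U \<and> x \<in> U \<and> Inl ` U \<subseteq> \<Union>\<K>" by (meson Union_upper subset_trans)
  next
    fix F assume "Inr F \<in> \<Union>\<K>"
    then obtain S where S: "S \<in> \<K>" "Inr F \<in> S" by blast
    with A obtain j where "end_nbhd Y K F j \<subseteq> S" unfolding end_open_def by meson
    with S show "\<exists>j. end_nbhd Y K F j \<subseteq> \<Union>\<K>" by (meson Union_upper subset_trans)
  qed
qed

lemma openin_end_topology: "openin (end_topology Y K) = end_open Y K"
  unfolding end_topology_def by (rule topology_inverse'[OF istopology_end_open])

lemma topspace_end_topology: "topspace (end_topology Y K) = end_space Y K"
proof -
  have sub: "F j \<subseteq> topspace Y" if "F \<in> ends Y K" for F j
    using that connected_components_of_subset[of "F j" "subtopology Y (topspace Y - K j)"]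
    unfolding ends_def by fastforce
  have "end_open Y K (end_space Y K)"
    unfolding end_open_def
  proof (intro conjI allI impI)
    fix x assume "Inl x \<in> end_space Y K"
    then show "\<exists>U. openin Y U \<and> x \<in> U \<and> Inl ` U \<subseteq> end_space Y K"
      by (intro exI[of _ "topspace Y"]) (auto simp: end_space_def)
  next
    fix F assume "Inr F \<in> end_space Y K"
    then have "F \<in> ends Y K" by (auto simp: end_space_def)
    then show "\<exists>j. end_nbhd Y K F j \<subseteq> end_space Y K"
      using sub[of F 0] by (intro exI[of _ 0]) (auto simp: end_nbhd_def end_space_def)
  qed simp
  moreover have "W \<subseteq> end_space Y K" if "end_open Y K W" for W
    using that by (simp add: end_open_def)
  ultimately show ?thesis
    unfolding topspace_def openin_end_topology by blast
qed

definition seq_compact_space :: "'a topology \<Rightarrow> bool" where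
  "seq_compact_space T \<longleftrightarrow>
     (\<forall>\<sigma>::nat \<Rightarrow> 'a. range \<sigma> \<subseteq> topspace T \<longrightarrow>
        (\<exists>l r. strict_mono r \<and> limitin T (\<sigma> \<circ> r) l sequentially))"


section \<open>The metric compactification\<close>

text \<open>\<open>Y\<close> is the domain as a space. Functions on it are represented by functions on the type which
  are \<open>undefined\<close> off \<open>topspace Y\<close>.\<close>
definition cont_funs :: "'a topology \<Rightarrow> ('a \<Rightarrow> real) set" where
  "cont_funs Y = {f \<in> extensional (topspace Y). continuous_map Y euclideanreal f}"

text \<open>Uniform convergence on compact sets, which is local uniform convergence since \<open>Y\<close> will be
  locally compact.\<close>
definition cont_funs_open :: "'a topology \<Rightarrow> ('a \<Rightarrow> real) set \<Rightarrow> bool" where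
  "cont_funs_open Y W \<longleftrightarrow>
     W \<subseteq> cont_funs Y \<and>
     (\<forall>f\<in>W. \<exists>C \<epsilon>. compactin Y C \<and> \<epsilon> > 0 \<and> {g \<in> cont_funs Y. \<forall>x\<in>C. \<bar>g x - f x\<bar> < \<epsilon>} \<subseteq> W)"

definition cont_funs_topology :: "'a topology \<Rightarrow> ('a \<Rightarrow> real) topology" where
  "cont_funs_topology Y = topology (cont_funs_open Y)"

definition const_rel :: "'a topology \<Rightarrow> (('a \<Rightarrow> real) \<times> ('a \<Rightarrow> real)) set" where
  "const_rel Y =
     {(f, g). f \<in> cont_funs Y \<and> g \<in> cont_funs Y \<and> (\<exists>c. \<forall>x\<in>topspace Y. g x = f x + c)}"

definition cstar_class :: "'a topology \<Rightarrow> ('a \<Rightarrow> real) \<Rightarrow> ('a \<Rightarrow> real) set" where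
  "cstar_class Y f = const_rel Y `` {f}"

definition cstar_topology :: "'a topology \<Rightarrow> ('a \<Rightarrow> real) set topology" where
  "cstar_topology Y =
     topology (\<lambda>W. W \<subseteq> cont_funs Y // const_rel Y \<and>
       openin (cont_funs_topology Y) {f \<in> cont_funs Y. cstar_class Y f \<in> W})"

definition metric_embedding :: "'a topology \<Rightarrow> ('a \<Rightarrow> 'a \<Rightarrow> real) \<Rightarrow> 'a \<Rightarrow> ('a \<Rightarrow> real) set" where
  "metric_embedding Y d x = cstar_class Y (restrict (d x) (topspace Y))"

definition metric_compactification ::
    "'a topology \<Rightarrow> ('a \<Rightarrow> 'a \<Rightarrow> real) \<Rightarrow> ('a \<Rightarrow> real) set topology" where
  "metric_compactification Y d =
     subtopology (cstar_topology Y)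
       (cstar_topology Y closure_of (metric_embedding Y d ` topspace Y))"

lemma istopology_cont_funs_open: "istopology (cont_funs_open Y)"
  unfolding istopology_def
proof (intro conjI allI impI)
  fix S T assume S: "cont_funs_open Y S" and T: "cont_funs_open Y T"
  show "cont_funs_open Y (S \<inter> T)"
    unfolding cont_funs_open_def
  proof (intro conjI ballI)
    show "S \<inter> T \<subseteq> cont_funs Y" using S by (auto simp: cont_funs_open_def)
  next
    fix f assume f: "f \<in> S \<inter> T"
    obtain C a where C: "compactin Y C" "a > 0" "{g \<in> cont_funs Y. \<forall>x\<in>C. \<bar>g x - f x\<bar> < a} \<subseteq> S"
      using S f unfolding cont_funs_open_def by (meson IntD1)
    obtain D b where D: "compactin Y D" "b > 0" "{g \<in> cont_funs Y. \<forall>x\<in>D. \<bar>g x - f x\<bar> < b} \<subseteq> T"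
      using T f unfolding cont_funs_open_def by (meson IntD2)
    show "\<exists>C \<epsilon>. compactin Y C \<and> \<epsilon> > 0 \<and> {g \<in> cont_funs Y. \<forall>x\<in>C. \<bar>g x - f x\<bar> < \<epsilon>} \<subseteq> S \<inter> T"
    proof (intro exI conjI)
      show "compactin Y (C \<union> D)" using C D by (simp add: compactin_Un)
      show "min a b > 0" using C D by simp
      show "{g \<in> cont_funs Y. \<forall>x\<in>C \<union> D. \<bar>g x - f x\<bar> < min a b} \<subseteq> S \<inter> T"
        using C(3) D(3) by (intro subsetI IntI) (auto dest!: subsetD)
    qed
  qed
next
  fix \<K> assume A: "\<forall>S\<in>\<K>. cont_funs_open Y S"
  show "cont_funs_open Y (\<Union>\<K>)"
    unfolding cont_funs_open_def
  proof (intro conjI ballI)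
    show "\<Union>\<K> \<subseteq> cont_funs Y" using A by (auto simp: cont_funs_open_def)
  next
    fix f assume "f \<in> \<Union>\<K>"
    then obtain S where S: "S \<in> \<K>" "f \<in> S" by blast
    with A obtain C a where "compactin Y C" "a > 0"
        "{g \<in> cont_funs Y. \<forall>x\<in>C. \<bar>g x - f x\<bar> < a} \<subseteq> S"
      unfolding cont_funs_open_def by meson
    with S show "\<exists>C \<epsilon>. compactin Y C \<and> \<epsilon> > 0 \<and>
        {g \<in> cont_funs Y. \<forall>x\<in>C. \<bar>g x - f x\<bar> < \<epsilon>} \<subseteq> \<Union>\<K>"
      by (meson Union_upper subset_trans)
  qed
qed

lemma openin_cont_funs_topology: "openin (cont_funs_topology Y) = cont_funs_open Y"
  unfolding cont_funs_topology_def by (rule topology_inverse'[OF istopology_cont_funs_open])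

lemma topspace_cont_funs_topology: "topspace (cont_funs_topology Y) = cont_funs Y"
proof -
  have "cont_funs_open Y (cont_funs Y)"
    unfolding cont_funs_open_def using compactin_empty zero_less_one by blast
  moreover have "W \<subseteq> cont_funs Y" if "cont_funs_open Y W" for W
    using that by (simp add: cont_funs_open_def)
  ultimately show ?thesis
    unfolding topspace_def openin_cont_funs_topology by blast
qed

lemma equiv_const_rel:
  fixes Y :: "'a topology"
  shows "equiv (cont_funs Y) (const_rel Y)"
proof (rule equivI)
  show "const_rel Y \<subseteq> cont_funs Y \<times> cont_funs Y" by (auto simp: const_rel_def)
  show "refl_on (cont_funs Y) (const_rel Y)"
    by (auto simp: refl_on_def const_rel_def intro: exI[of _ 0])
  show "sym (const_rel Y)"
    unfolding sym_def const_rel_def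
  proof clarify
    fix f g :: "'a \<Rightarrow> real" and c :: real assume "\<forall>x\<in>topspace Y. g x = f x + c"
    then show "\<exists>c. \<forall>x\<in>topspace Y. f x = g x + c" by (intro exI[of _ "- c"]) auto
  qed
  show "trans (const_rel Y)"
    unfolding trans_def const_rel_def
  proof clarify
    fix f g h :: "'a \<Rightarrow> real" and c c' :: real assume "\<forall>x\<in>topspace Y. g x = f x + c" "\<forall>x\<in>topspace Y. h x = g x + c'"
    then show "\<exists>c. \<forall>x\<in>topspace Y. h x = f x + c" by (intro exI[of _ "c + c'"]) auto
  qed
qed

lemma openin_cstar_topology:
  "openin (cstar_topology Y) W \<longleftrightarrow>
     W \<subseteq> cont_funs Y // const_rel Y \<and>
     openin (cont_funs_topology Y) {f \<in> cont_funs Y. cstar_class Y f \<in> W}"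
proof -
  let ?P = "\<lambda>W. {f \<in> cont_funs Y. cstar_class Y f \<in> W}"
  have "istopology (\<lambda>W. W \<subseteq> cont_funs Y // const_rel Y \<and> openin (cont_funs_topology Y) (?P W))"
    unfolding istopology_def
  proof (intro conjI allI impI)
    fix S T
    assume "S \<subseteq> cont_funs Y // const_rel Y \<and> openin (cont_funs_topology Y) (?P S)"
      and "T \<subseteq> cont_funs Y // const_rel Y \<and> openin (cont_funs_topology Y) (?P T)"
    moreover have "?P (S \<inter> T) = ?P S \<inter> ?P T" by blast
    ultimately show "S \<inter> T \<subseteq> cont_funs Y // const_rel Y"
      and "openin (cont_funs_topology Y) (?P (S \<inter> T))" by auto
  next
    fix \<K>
    assume "\<forall>S\<in>\<K>. S \<subseteq> cont_funs Y // const_rel Y \<and> openin (cont_funs_topology Y) (?P S)"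
    moreover have "?P (\<Union>\<K>) = \<Union>(?P ` \<K>)" by blast
    ultimately show "\<Union>\<K> \<subseteq> cont_funs Y // const_rel Y"
      and "openin (cont_funs_topology Y) (?P (\<Union>\<K>))" by auto
  qed
  from topology_inverse'[OF this] show ?thesis
    unfolding cstar_topology_def by simp
qed

lemma quotient_map_cstar_class:
  "quotient_map (cont_funs_topology Y) (cstar_topology Y) (cstar_class Y)"
proof -
  have cls: "cstar_class Y ` cont_funs Y = cont_funs Y // const_rel Y"
    by (auto simp: cstar_class_def quotient_def)
  have "{f \<in> cont_funs Y. cstar_class Y f \<in> cont_funs Y // const_rel Y} = cont_funs Y"
    using cls by blast
  then have "openin (cstar_topology Y) (cont_funs Y // const_rel Y)"
    using openin_topspace[of "cont_funs_topology Y"]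
    by (simp add: openin_cstar_topology topspace_cont_funs_topology)
  then have "topspace (cstar_topology Y) = cont_funs Y // const_rel Y"
    unfolding topspace_def using openin_cstar_topology by blast
  then show ?thesis
    by (simp add: quotient_map_def topspace_cont_funs_topology cls openin_cstar_topology)
qed

end

theory Submission
  imports Defs "HOL-Complex_Analysis.Riemann_Mapping"
begin

text \<open>
  A geodesic ray converges in the metric compactification because its Busemann function exists. By
  the triangle inequality the functions \<open>k(\<gamma> t, \<cdot>) - t\<close> are nonincreasing in \<open>t\<close>, and they are bounded below by
  \<open>- k(\<gamma> 0, \<cdot>)\<close>; hence they converge pointwise. They are all \<open>1\<close>-Lipschitz for \<open>k\<close>, so the convergence
  is uniform on compact sets. Modulo constants these functions are the points \<open>i\<^sub>k(\<gamma> t)\<close>, which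
  therefore converge to the class \<open>\<xi>\<close> of the Busemann function
  (\<open>geodesic_ray_converges_in_metric_compactification\<close>). Continuity of \<open>F\<close> and
  \<open>F \<circ> i\<^sub>k = i\<^sub>\<Omega>\<close> turn this into \<open>\<gamma> t \<longlongrightarrow> F \<xi>\<close> in the end compactification.

  The limit is not a point \<open>x\<close> of \<open>\<Omega>\<close>: otherwise \<open>\<gamma>\<close> would eventually stay in a set on which
  \<open>k(x, \<cdot>) < 1\<close>, although it moves away from each of its own points at unit speed.

  Both halves compare two topologies on \<open>\<Omega>\<close>: the compact and the open sets are those of the
  manifold, while the estimates are in terms of \<open>k\<close>. What links them is
  \<open>kobayashi_dist_small_near\<close>: every \<open>k\<close>-ball is a neighbourhood of its centre in the manifold
  topology, because nearby points are joined by an affine disc in a chart.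
\<close>

section \<open>The Kobayashi distance is dominated by the manifold topology\<close>

lemma poincare_dist_nonneg:
  assumes "z \<in> unit_disc" "w \<in> unit_disc"
  shows "0 \<le> poincare_dist z w"
proof -
  define r where "r = cmod ((z - w) / (1 - cnj w * z))"
  have "r < 1"
    using Moebius_function_norm_lt_1[of w z 0] assms
    by (simp add: Moebius_function_simple r_def)
  moreover have "0 \<le> r" by (simp add: r_def)
  ultimately show ?thesis
    by (simp add: poincare_dist_def artanh_def flip: r_def)
qed

text \<open>A single disc is a chain of length one. Nonnegativity of the Poincare distance is what makes the
  infimum over all chains a lower bound.\<close>
lemma kobayashi_dist_le_poincare_dist:
  assumes f: "f \<in> holomorphic_discs X \<A> \<Omega>"
    and disc: "\<zeta> \<in> unit_disc" "\<omega> \<in> unit_disc"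
    and "f \<zeta> \<in> \<Omega>" "f \<omega> \<in> \<Omega>"
  shows "kobayashi_dist X \<A> \<Omega> (f \<zeta>) (f \<omega>) \<le> poincare_dist \<zeta> \<omega>"
proof -
  let ?L = "disc_chain_lengths X \<A> \<Omega> (f \<zeta>) (f \<omega>)"
  have "0 \<le> l" if "l \<in> ?L" for l
    using that poincare_dist_nonneg
    unfolding disc_chain_lengths_def by (fastforce intro: sum_nonneg)
  then have "bdd_below ?L" by (meson bdd_belowI)
  moreover have "poincare_dist \<zeta> \<omega> \<in> ?L"
    unfolding disc_chain_lengths_def mem_Collect_eq
    by (rule exI[of _ 0], rule exI[of _ "\<lambda>j. if j = 0 then f \<zeta> else f \<omega>"],
        rule exI[of _ "\<lambda>_. f"], rule exI[of _ "\<lambda>_. \<zeta>"], rule exI[of _ "\<lambda>_. \<omega>"])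
       (use f disc in auto)
  ultimately show ?thesis
    using assms by (simp add: kobayashi_dist_def cInf_lower)
qed

lemma affine_line_has_derivative:
  fixes v :: "complex ^ 'n::finite"
  shows "((\<lambda>\<zeta>. p + \<zeta> *s v) has_derivative (\<lambda>h. h *s v)) F"
proof -
  have "bounded_linear (\<lambda>h::complex. h *s v)"
    by (intro linear_conv_bounded_linear[THEN iffD1] linearI)
       (auto simp: vec_eq_iff algebra_simps)
  then show ?thesis
    by (auto intro!: derivative_eq_intros bounded_linear_imp_has_derivative)
qed

lemma norm_scalar_mult_cvec:
  fixes v :: "complex ^ 'n::finite"
  shows "norm (c *s v) = cmod c * norm v"
  by (simp add: norm_vec_def norm_mult L2_set_right_distrib)

text \<open>Transition maps have complex-linear derivatives, so an affine complex line in one chart is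
  holomorphic when read in any other chart.\<close>
lemma affine_disc_in_chart:
  fixes \<A> :: "('a, 'n::finite) chart set"
  assumes X: "complex_manifold X \<A>" and chart: "(V, \<phi>) \<in> \<A>"
    and line: "\<And>\<zeta>. \<zeta> \<in> unit_disc \<Longrightarrow> p + \<zeta> *s v \<in> \<phi> ` (V \<inter> \<Omega>)"
  shows "(\<lambda>\<zeta>. inv_into V \<phi> (p + \<zeta> *s v)) \<in> holomorphic_discs X \<A> \<Omega>"
proof -
  let ?g = "inv_into V \<phi>" and ?a = "\<lambda>\<zeta>. p + \<zeta> *s v"
  have V: "openin X V" and hom: "homeomorphic_map (subtopology X V) (top_of_set (\<phi> ` V)) \<phi>"
    using X chart unfolding complex_manifold_def by fast+
  have tV: "topspace (subtopology X V) = V"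
    using V openin_subset by fastforce
  have inj: "inj_on \<phi> V"
    using homeomorphic_imp_injective_map[OF hom] tV by simp
  obtain g' where g': "homeomorphic_maps (subtopology X V) (top_of_set (\<phi> ` V)) \<phi> g'"
    using hom homeomorphic_map_maps by blast
  then have "?g z = g' z" if "z \<in> \<phi> ` V" for z
    using that inj tV by (auto simp: homeomorphic_maps_def)
  then have g: "continuous_map (top_of_set (\<phi> ` V)) (subtopology X V) ?g"
    using g' by (auto simp: homeomorphic_maps_def intro: continuous_map_eq)
  have gmem: "?g (?a \<zeta>) \<in> V \<inter> \<Omega> \<and> \<phi> (?g (?a \<zeta>)) = ?a \<zeta>" if \<zeta>: "\<zeta> \<in> unit_disc" for \<zeta>
  proof -
    obtain u where "u \<in> V \<inter> \<Omega>" "?a \<zeta> = \<phi> u" using line[OF \<zeta>] by blast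
    then show ?thesis using inv_into_f_f[OF inj, of u] by simp
  qed
  have "continuous_on unit_disc ?a"
    by (rule has_derivative_continuous_on) (rule affine_line_has_derivative)
  then have "continuous_map (top_of_set unit_disc) (top_of_set (\<phi> ` V)) ?a"
    using line by (fastforce simp: continuous_map_in_subtopology)
  from continuous_map_compose[OF this g]
  have cont: "continuous_map (top_of_set unit_disc) (subtopology X \<Omega>) (\<lambda>\<zeta>. ?g (?a \<zeta>))"
    using gmem by (auto simp: continuous_map_in_subtopology o_def)
  have "(\<lambda>\<zeta>. \<psi> (?g (?a \<zeta>)) $ i) holomorphic_on {\<zeta> \<in> unit_disc. ?g (?a \<zeta>) \<in> W}"
    if W: "(W, \<psi>) \<in> \<A>" for W \<psi> i
    unfolding holomorphic_on_def
  proof (intro ballI)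
    let ?S = "{\<zeta> \<in> unit_disc. ?g (?a \<zeta>) \<in> W}"
    fix \<zeta> assume \<zeta>: "\<zeta> \<in> ?S"
    have "?a \<zeta> \<in> \<phi> ` (V \<inter> W)"
      using \<zeta> gmem[of \<zeta>] by (auto intro: rev_image_eqI)
    moreover have "holomorphic_vec_on (\<psi> \<circ> ?g) (\<phi> ` (V \<inter> W))"
      using X chart W unfolding complex_manifold_def by fast
    ultimately obtain D where D: "((\<psi> \<circ> ?g) has_derivative D) (at (?a \<zeta>))"
      and lin: "\<And>c u. D (c *s u) = c *s D u"
      unfolding holomorphic_vec_on_def by blast
    have "((\<lambda>\<zeta>. (\<psi> \<circ> ?g) (?a \<zeta>)) has_derivative (\<lambda>h. D (h *s v))) (at \<zeta> within ?S)"
      by (rule has_derivative_compose[OF affine_line_has_derivative D])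
    then have "((\<lambda>\<zeta>. (\<psi> \<circ> ?g) (?a \<zeta>) $ i) has_derivative (\<lambda>h. D (h *s v) $ i)) (at \<zeta> within ?S)"
      by (rule bounded_linear.has_derivative[OF bounded_linear_vec_nth])
    moreover have "(\<lambda>h. D (h *s v) $ i) = (*) (D v $ i)"
      by (auto simp: lin)
    ultimately show "(\<lambda>\<zeta>. \<psi> (?g (?a \<zeta>)) $ i) field_differentiable (at \<zeta> within ?S)"
      unfolding field_differentiable_def has_field_derivative_def by auto
  qed
  with cont show ?thesis
    unfolding holomorphic_discs_def by blast
qed

text \<open>In a chart, take a ball of radius \<open>r\<close> around the image of \<open>x\<close> that stays inside \<open>\<Omega>\<close>. A point at
  Euclidean distance \<open>s < r\<close> from the centre lies on an affine disc of radius \<open>r\<close>, at parameter \<open>s / r\<close>,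
  so its Kobayashi distance from \<open>x\<close> is at most \<open>artanh (s / r)\<close>. This is less than \<open>\<epsilon>\<close> for
  \<open>s < r * tanh \<epsilon>\<close>.\<close>
lemma kobayashi_dist_small_near:
  fixes \<A> :: "('a, 'n::finite) chart set"
  assumes X: "complex_manifold X \<A>" and \<Omega>: "openin X \<Omega>" and x: "x \<in> \<Omega>" and \<epsilon>: "\<epsilon> > 0"
  obtains U where "openin X U" "x \<in> U" "U \<subseteq> \<Omega>" "\<And>y. y \<in> U \<Longrightarrow> kobayashi_dist X \<A> \<Omega> x y < \<epsilon>"
proof -
  have "x \<in> topspace X" using \<Omega> x openin_subset by blast
  then obtain V \<phi> where chart: "(V, \<phi>) \<in> \<A>" and xV: "x \<in> V"
    using X unfolding complex_manifold_def by auto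
  have V: "openin X V" and oV: "open (\<phi> ` V)"
    and hom: "homeomorphic_map (subtopology X V) (top_of_set (\<phi> ` V)) \<phi>"
    using X chart unfolding complex_manifold_def by fast+
  have tV: "topspace (subtopology X V) = V"
    using V openin_subset by fastforce
  have inj: "inj_on \<phi> V"
    using homeomorphic_imp_injective_map[OF hom] tV by simp
  have VO: "openin (subtopology X V) (V \<inter> \<Omega>)"
    using V \<Omega> by (simp add: openin_open_subtopology openin_Int)
  then have "openin (top_of_set (\<phi> ` V)) (\<phi> ` (V \<inter> \<Omega>))"
    using homeomorphic_imp_open_map[OF hom] by (simp add: open_map_def)
  then have "open (\<phi> ` (V \<inter> \<Omega>))"
    using oV by (simp add: openin_open_eq)
  then obtain r where r: "r > 0" "ball (\<phi> x) r \<subseteq> \<phi> ` (V \<inter> \<Omega>)"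
    using xV x open_contains_ball by blast
  define U where "U = {y \<in> V \<inter> \<Omega>. \<phi> y \<in> ball (\<phi> x) (r * tanh \<epsilon>)}"
  have "openin (subtopology X V) {y \<in> V \<inter> \<Omega>. \<phi> y \<in> \<phi> ` V \<inter> ball (\<phi> x) (r * tanh \<epsilon>)}"
    by (rule openin_continuous_map_preimage_gen[OF homeomorphic_imp_continuous_map[OF hom] VO])
       (simp add: openin_open_Int)
  moreover have "{y \<in> V \<inter> \<Omega>. \<phi> y \<in> \<phi> ` V \<inter> ball (\<phi> x) (r * tanh \<epsilon>)} = U"
    by (auto simp: U_def)
  ultimately have "openin X U"
    using V by (simp add: openin_open_subtopology)
  moreover have "x \<in> U" using x xV r(1) \<epsilon> by (simp add: U_def)
  moreover have "U \<subseteq> \<Omega>" by (auto simp: U_def)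
  moreover have "kobayashi_dist X \<A> \<Omega> x y < \<epsilon>" if y: "y \<in> U" for y
  proof -
    define s where "s = norm (\<phi> y - \<phi> x)"
    have s: "s / r < tanh \<epsilon>" "0 \<le> s / r"
      using y r(1) by (auto simp: U_def s_def dist_norm norm_minus_commute field_simps)
    then have s1: "s / r < 1" using tanh_real_lt_1 order.strict_trans by blast
    \<comment> \<open>For \<open>y = x\<close>, division by zero makes \<open>v = 0\<close>, and the constant disc does what is needed.\<close>
    define v where "v = complex_of_real (r / s) *s (\<phi> y - \<phi> x)"
    define f where "f = (\<lambda>\<zeta>. inv_into V \<phi> (\<phi> x + \<zeta> *s v))"
    have "norm v = \<bar>r / s\<bar> * s"
      unfolding v_def norm_scalar_mult_cvec norm_of_real by (simp add: s_def)
    then have v: "norm v \<le> r"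
      using r(1) by (simp add: s_def)
    have "\<phi> x + \<zeta> *s v \<in> \<phi> ` (V \<inter> \<Omega>)" if "\<zeta> \<in> unit_disc" for \<zeta>
    proof -
      have "cmod \<zeta> * norm v \<le> cmod \<zeta> * r" using v by (simp add: mult_left_mono)
      also have "\<dots> < r" using that r(1) by simp
      finally show ?thesis
        using r(2) by (auto simp: dist_norm norm_scalar_mult_cvec intro!: subsetD[OF r(2)])
    qed
    then have f: "f \<in> holomorphic_discs X \<A> \<Omega>"
      unfolding f_def by (rule affine_disc_in_chart[OF X chart])
    have f0: "f 0 = x" using xV inj by (simp add: f_def)
    have "complex_of_real (s / r) *s v = \<phi> y - \<phi> x"
      using r(1) by (cases "s = 0") (auto simp: v_def s_def)
    then have fy: "f (complex_of_real (s / r)) = y"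
      using y inj by (simp add: f_def U_def)
    have "kobayashi_dist X \<A> \<Omega> (f 0) (f (complex_of_real (s / r)))
        \<le> poincare_dist 0 (complex_of_real (s / r))"
    proof (rule kobayashi_dist_le_poincare_dist[OF f])
      show "complex_of_real (s / r) \<in> unit_disc"
        using s s1 by (simp only: mem_ball_0 norm_of_real abs_of_nonneg)
      show "f 0 \<in> \<Omega>" "f (complex_of_real (s / r)) \<in> \<Omega>"
        unfolding f0 fy using x y by (auto simp: U_def)
    qed simp
    also have "\<dots> = artanh (s / r)"
      using s(2) unfolding poincare_dist_def by (simp add: norm_divide flip: abs_divide)
    also have "\<dots> < artanh (tanh \<epsilon>)"
      using s s1 tanh_real_lt_1[of \<epsilon>] unfolding artanh_def
      by (intro divide_strict_right_mono ln_less_cancel_iff[THEN iffD2] frac_less) auto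
    also have "\<dots> = \<epsilon>" by (rule artanh_tanh_real)
    finally show ?thesis unfolding f0 fy .
  qed
  ultimately show thesis using that by blast
qed

section \<open>Busemann functions in the metric compactification\<close>

text \<open>The hypothesis \<open>fine\<close>, here and below, says that the topology of \<open>Y\<close> is at least as fine as the one
  given by \<open>d\<close>; for the Kobayashi distance this is \<open>kobayashi_dist_small_near\<close>.\<close>
lemma continuous_map_if_1_lipschitz:
  assumes fine: "\<And>x \<epsilon>. x \<in> topspace Y \<Longrightarrow> \<epsilon> > 0 \<Longrightarrow> \<exists>U. openin Y U \<and> x \<in> U \<and> (\<forall>y\<in>U. d x y < \<epsilon>)"
    and lip: "\<And>x y. x \<in> topspace Y \<Longrightarrow> y \<in> topspace Y \<Longrightarrow> \<bar>f x - f y\<bar> \<le> d x y"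
  shows "continuous_map Y euclideanreal f"
  unfolding continuous_map_def
proof (intro conjI allI impI)
  fix S :: "real set" assume "openin euclidean S"
  then have S: "open S" by simp
  show "openin Y {x \<in> topspace Y. f x \<in> S}"
  proof (subst openin_subopen, intro ballI)
    fix x assume x: "x \<in> {x \<in> topspace Y. f x \<in> S}"
    then obtain \<epsilon> where \<epsilon>: "\<epsilon> > 0" "ball (f x) \<epsilon> \<subseteq> S"
      using S open_contains_ball by blast
    obtain U where U: "openin Y U" "x \<in> U" "\<forall>y\<in>U. d x y < \<epsilon>"
      using fine[of x \<epsilon>] x \<epsilon>(1) by blast
    have "y \<in> topspace Y \<and> f y \<in> S" if "y \<in> U" for y
    proof -
      have y: "y \<in> topspace Y" using that U(1) openin_subset by blast
      then have "\<bar>f x - f y\<bar> < \<epsilon>"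
        using lip[of x y] x U(3) that by force
      then show ?thesis using y \<epsilon>(2) by (auto simp: dist_real_def)
    qed
    with U show "\<exists>T. openin Y T \<and> x \<in> T \<and> T \<subseteq> {x \<in> topspace Y. f x \<in> S}" by blast
  qed
qed simp

text \<open>Equicontinuity upgrades pointwise to uniform convergence: a compact set is covered by finitely
  many sets of \<open>d\<close>-radius \<open>\<epsilon> / 3\<close>, and it suffices to control the functions at their centres.\<close>
lemma uniform_on_compact_if_1_lipschitz:
  fixes h :: "'b \<Rightarrow> 'a \<Rightarrow> real"
  assumes fine: "\<And>x \<epsilon>. x \<in> topspace Y \<Longrightarrow> \<epsilon> > 0 \<Longrightarrow> \<exists>U. openin Y U \<and> x \<in> U \<and> (\<forall>y\<in>U. d x y < \<epsilon>)"
    and lip: "\<forall>\<^sub>F t in T. \<forall>x\<in>topspace Y. \<forall>y\<in>topspace Y. \<bar>h t x - h t y\<bar> \<le> d x y"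
    and blip: "\<And>x y. x \<in> topspace Y \<Longrightarrow> y \<in> topspace Y \<Longrightarrow> \<bar>b x - b y\<bar> \<le> d x y"
    and lim: "\<And>x. x \<in> topspace Y \<Longrightarrow> ((\<lambda>t. h t x) \<longlongrightarrow> b x) T"
    and C: "compactin Y C" and \<epsilon>: "\<epsilon> > 0"
  shows "\<forall>\<^sub>F t in T. \<forall>x\<in>C. \<bar>h t x - b x\<bar> < \<epsilon>"
proof -
  have CY: "C \<subseteq> topspace Y" using C compactin_subset_topspace by blast
  have "\<forall>x\<in>C. \<exists>U. openin Y U \<and> x \<in> U \<and> (\<forall>y\<in>U. d x y < \<epsilon> / 3)"
    using CY \<epsilon> by (intro ballI fine) auto
  then obtain U where U: "\<And>x. x \<in> C \<Longrightarrow> openin Y (U x) \<and> x \<in> U x \<and> (\<forall>y\<in>U x. d x y < \<epsilon> / 3)"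
    by metis
  then obtain \<F> where \<F>: "finite \<F>" "\<F> \<subseteq> U ` C" "C \<subseteq> \<Union>\<F>"
    using compactinD[OF C, of "U ` C"] by blast
  then obtain N where N: "N \<subseteq> C" "finite N" "\<F> = U ` N"
    by (meson finite_subset_image)
  have "\<forall>\<^sub>F t in T. \<forall>x\<in>N. dist (h t x) (b x) < \<epsilon> / 3"
    using N CY \<epsilon> by (intro eventually_ball_finite ballI N tendstoD[OF lim]) auto
  with lip show ?thesis
  proof eventually_elim
    case (elim t)
    show ?case
    proof
      fix y assume y: "y \<in> C"
      then obtain x where x: "x \<in> N" "y \<in> U x" using \<F> N by blast
      then have "d x y < \<epsilon> / 3" using U N by blast
      moreover have "\<bar>h t x - h t y\<bar> \<le> d x y" "\<bar>b x - b y\<bar> \<le> d x y"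
        using elim blip x y N CY by blast+
      moreover have "\<bar>h t x - b x\<bar> < \<epsilon> / 3" using elim x by (simp add: dist_real_def)
      ultimately show "\<bar>h t y - b y\<bar> < \<epsilon>" by linarith
    qed
  qed
qed

lemma limitin_cont_funs_topologyI:
  assumes "b \<in> cont_funs Y" "\<forall>\<^sub>F t in T. h t \<in> cont_funs Y"
    and "\<And>C \<epsilon>. compactin Y C \<Longrightarrow> \<epsilon> > 0 \<Longrightarrow> \<forall>\<^sub>F t in T. \<forall>x\<in>C. \<bar>h t x - b x\<bar> < \<epsilon>"
  shows "limitin (cont_funs_topology Y) h b T"
  unfolding limitin_def topspace_cont_funs_topology openin_cont_funs_topology
proof (intro conjI allI impI)
  fix W assume W: "cont_funs_open Y W \<and> b \<in> W"
  then obtain C \<epsilon> where C: "compactin Y C" "\<epsilon> > 0"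
      and sub: "{g \<in> cont_funs Y. \<forall>x\<in>C. \<bar>g x - b x\<bar> < \<epsilon>} \<subseteq> W"
    unfolding cont_funs_open_def by meson
  from assms(2) assms(3)[OF C] show "\<forall>\<^sub>F t in T. h t \<in> W"
    by eventually_elim (use sub in blast)
qed (rule assms(1))

text \<open>This is what allows the normalisation by \<open>- t\<close>: it changes the function but not its class.\<close>
lemma cstar_class_eq_if_diff_const:
  assumes "f \<in> cont_funs Y" "g \<in> cont_funs Y" "\<And>x. x \<in> topspace Y \<Longrightarrow> g x = f x + c"
  shows "cstar_class Y f = cstar_class Y g"
  unfolding cstar_class_def
  by (rule equiv_class_eq[OF equiv_const_rel]) (use assms in \<open>auto simp: const_rel_def\<close>)

text \<open>On \<open>t \<ge> 0\<close> the function is nonincreasing and bounded below, both by the triangle inequality along the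
  ray; its limit is the value at \<open>x\<close> of the Busemann function.\<close>
lemma busemann_limit:
  assumes "Metric_space M d" and ray: "geodesic_ray M d \<gamma>" and x: "x \<in> M"
  shows "\<exists>l. ((\<lambda>t. d (\<gamma> t) x - t) \<longlongrightarrow> l) at_top"
proof -
  interpret Metric_space M d by fact
  have \<gamma>: "\<gamma> t \<in> M" if "t \<ge> 0" for t using ray that by (simp add: geodesic_ray_def)
  have dist: "d (\<gamma> s) (\<gamma> t) = \<bar>s - t\<bar>" if "s \<ge> 0" "t \<ge> 0" for s t
    using ray that by (simp add: geodesic_ray_def)
  define \<beta> where "\<beta> t = d (\<gamma> t) x - t" for t
  have anti: "\<beta> t \<le> \<beta> s" if "0 \<le> s" "s \<le> t" for s t
    using triangle[of "\<gamma> t" "\<gamma> s" x] \<gamma>[of s] \<gamma>[of t] x dist[of t s] that by (simp add: \<beta>_def)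
  have lower: "- d (\<gamma> 0) x \<le> \<beta> t" if "0 \<le> t" for t
    using triangle'[of "\<gamma> 0" x "\<gamma> t"] \<gamma>[of 0] \<gamma>[of t] x dist[of 0 t] that by (simp add: \<beta>_def)
  define l where "l = Inf (\<beta> ` {0..})"
  have bdd: "bdd_below (\<beta> ` {0..})" using lower by (intro bdd_belowI2) auto
  have "(\<beta> \<longlongrightarrow> l) at_top"
  proof (rule order_tendstoI)
    fix a assume "a < l"
    moreover have "l \<le> \<beta> t" if "t \<ge> 0" for t
      unfolding l_def using bdd that by (auto intro: cInf_lower)
    ultimately have "a < \<beta> t" if "t \<ge> 0" for t using that order.strict_trans2 by blast
    then show "\<forall>\<^sub>F t in at_top. a < \<beta> t" by (intro eventually_mono[OF eventually_ge_at_top[of 0]]) blast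
  next
    fix a assume "l < a"
    then obtain s where s: "s \<ge> 0" "\<beta> s < a"
      unfolding l_def using cInf_less_iff[OF _ bdd] by auto
    then have "\<beta> t < a" if "t \<ge> s" for t using anti[of s t] that by linarith
    then show "\<forall>\<^sub>F t in at_top. \<beta> t < a" by (intro eventually_mono[OF eventually_ge_at_top[of s]]) blast
  qed
  then show ?thesis unfolding \<beta>_def by blast
qed

text \<open>The limit is the class of the Busemann function. Since the quotient map is continuous, it is
  enough to work with representatives in the space of continuous functions.\<close>
lemma geodesic_ray_converges_in_metric_compactification:
  assumes MS: "Metric_space (topspace Y) d"
    and fine: "\<And>x \<epsilon>. x \<in> topspace Y \<Longrightarrow> \<epsilon> > 0 \<Longrightarrow> \<exists>U. openin Y U \<and> x \<in> U \<and> (\<forall>y\<in>U. d x y < \<epsilon>)"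
    and ray: "geodesic_ray (topspace Y) d \<gamma>"
  shows "\<exists>\<xi>. limitin (metric_compactification Y d) (\<lambda>t. metric_embedding Y d (\<gamma> t)) \<xi> at_top"
proof -
  interpret Metric_space "topspace Y" d by fact
  let ?M = "topspace Y"
  have \<gamma>: "\<gamma> t \<in> ?M" if "t \<ge> 0" for t using ray that by (simp add: geodesic_ray_def)
  have nonneg_time: "\<forall>\<^sub>F t::real in at_top. t \<ge> 0" by (rule eventually_ge_at_top)
  \<comment> \<open>Without the subtraction of \<open>t\<close> the functions tend to infinity; with it they represent the
    same classes and converge.\<close>
  define h where "h t = restrict (\<lambda>x. d (\<gamma> t) x - t) ?M" for t
  obtain b where b: "\<And>x. x \<in> ?M \<Longrightarrow> ((\<lambda>t. d (\<gamma> t) x - t) \<longlongrightarrow> b x) at_top"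
    using busemann_limit[OF MS ray] by metis
  have hlim: "((\<lambda>t. h t x) \<longlongrightarrow> b x) at_top" if "x \<in> ?M" for x
    using b[OF that] that by (simp add: h_def)
  have dlip: "\<bar>d p x - d p y\<bar> \<le> d x y" if "p \<in> ?M" "x \<in> ?M" "y \<in> ?M" for p x y
    using mdist_reverse_triangle[of x p y] that by (simp add: commute)
  have hlip: "\<bar>h t x - h t y\<bar> \<le> d x y" if "t \<ge> 0" "x \<in> ?M" "y \<in> ?M" for t x y
    using dlip[OF \<gamma>] that by (simp add: h_def)
  have blip: "\<bar>b x - b y\<bar> \<le> d x y" if "x \<in> ?M" "y \<in> ?M" for x y
  proof (rule tendsto_upperbound)
    show "((\<lambda>t. \<bar>h t x - h t y\<bar>) \<longlongrightarrow> \<bar>b x - b y\<bar>) at_top"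
      using hlim that by (intro tendsto_intros)
    show "\<forall>\<^sub>F t in at_top. \<bar>h t x - h t y\<bar> \<le> d x y"
      using nonneg_time by eventually_elim (use hlip that in blast)
  qed simp
  have restrict_in: "restrict f ?M \<in> cont_funs Y"
    if "\<And>x y. x \<in> ?M \<Longrightarrow> y \<in> ?M \<Longrightarrow> \<bar>f x - f y\<bar> \<le> d x y" for f
  proof -
    have "continuous_map Y euclideanreal (restrict f ?M)"
      by (rule continuous_map_if_1_lipschitz[OF fine]) (use that in auto)
    then show ?thesis unfolding cont_funs_def by blast
  qed
  have h: "h t \<in> cont_funs Y" if "t \<ge> 0" for t
    unfolding h_def by (rule restrict_in) (use dlip[OF \<gamma>] that in auto)
  have bC: "restrict b ?M \<in> cont_funs Y" by (rule restrict_in[OF blip])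
  have dC: "restrict (d p) ?M \<in> cont_funs Y" if "p \<in> ?M" for p
    by (rule restrict_in[OF dlip[OF that]])
  have "limitin (cont_funs_topology Y) h (restrict b ?M) at_top"
  proof (rule limitin_cont_funs_topologyI[OF bC])
    show "\<forall>\<^sub>F t in at_top. h t \<in> cont_funs Y"
      using nonneg_time by eventually_elim (rule h)
    fix C and \<epsilon> :: real assume C: "compactin Y C" "\<epsilon> > 0"
    show "\<forall>\<^sub>F t in at_top. \<forall>x\<in>C. \<bar>h t x - restrict b ?M x\<bar> < \<epsilon>"
    proof (rule uniform_on_compact_if_1_lipschitz[OF fine _ _ _ C])
      show "\<forall>\<^sub>F t in at_top. \<forall>x\<in>?M. \<forall>y\<in>?M. \<bar>h t x - h t y\<bar> \<le> d x y"
        using nonneg_time by eventually_elim (use hlip in blast)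
    qed (use hlim blip in auto)
  qed
  then have lim: "limitin (cstar_topology Y) (cstar_class Y \<circ> h) (cstar_class Y (restrict b ?M)) at_top"
    by (rule continuous_map_limit[OF quotient_imp_continuous_map[OF quotient_map_cstar_class]])
  have "cstar_class Y (h t) = metric_embedding Y d (\<gamma> t)" if t: "t \<ge> 0" for t
    unfolding metric_embedding_def
  proof (rule cstar_class_eq_if_diff_const[OF h[OF t]])
    show "restrict (d (\<gamma> t)) ?M \<in> cont_funs Y"
      by (rule dC[OF \<gamma>[OF t]])
    show "restrict (d (\<gamma> t)) ?M x = h t x + t" if "x \<in> ?M" for x
      using that by (simp add: h_def)
  qed
  then have "\<forall>\<^sub>F t in at_top. (cstar_class Y \<circ> h) t = metric_embedding Y d (\<gamma> t)"
    by (intro eventually_mono[OF nonneg_time]) simp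
  then have lim': "limitin (cstar_topology Y) (\<lambda>t. metric_embedding Y d (\<gamma> t))
      (cstar_class Y (restrict b ?M)) at_top"
    using lim by (rule limitin_transform_eventually)
  have im: "\<forall>\<^sub>F t in at_top. metric_embedding Y d (\<gamma> t) \<in> metric_embedding Y d ` ?M"
    using nonneg_time by eventually_elim (use \<gamma> in blast)
  have S: "metric_embedding Y d ` ?M \<subseteq> topspace (cstar_topology Y)"
    using quotient_imp_surjective_map[OF quotient_map_cstar_class, of Y] dC
    by (auto simp: metric_embedding_def topspace_cont_funs_topology)
  \<comment> \<open>The compactification carries the subspace topology of a closure, so the limit and the tail of
    the ray have to be placed in that closure.\<close>
  have closure: "cstar_class Y (restrict b ?M) \<in> cstar_topology Y closure_of (metric_embedding Y d ` ?M)"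
    unfolding in_closure_of
  proof (intro conjI allI impI)
    show "cstar_class Y (restrict b ?M) \<in> topspace (cstar_topology Y)"
      by (rule limitin_topspace[OF lim'])
    fix W assume "cstar_class Y (restrict b ?M) \<in> W \<and> openin (cstar_topology Y) W"
    then have "\<forall>\<^sub>F t in at_top. metric_embedding Y d (\<gamma> t) \<in> W"
      by (intro limitinD[OF lim']) auto
    from eventually_happens'[OF trivial_limit_at_top_linorder eventually_conj[OF this im]]
    show "\<exists>y. y \<in> metric_embedding Y d ` ?M \<and> y \<in> W" by blast
  qed
  moreover have "\<forall>\<^sub>F t in at_top. metric_embedding Y d (\<gamma> t)
      \<in> cstar_topology Y closure_of (metric_embedding Y d ` ?M)"
    using im by eventually_elim (use closure_of_subset[OF S] in blast)
  ultimately have "limitin (metric_compactification Y d) (\<lambda>t. metric_embedding Y d (\<gamma> t))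
      (cstar_class Y (restrict b ?M)) at_top"
    using lim' by (simp add: metric_compactification_def limitin_subtopology)
  then show ?thesis ..
qed

section \<open>Landing of geodesic rays\<close>

text \<open>Hence convergence to a point of \<open>Y\<close> in the end compactification forces eventual membership in each
  of its neighbourhoods in \<open>Y\<close>. The set \<open>Inl ` U\<close> contains no end, so only points of \<open>U\<close> need checking.\<close>
lemma openin_end_topology_Inl:
  assumes "openin Y U"
  shows "openin (end_topology Y K) (Inl ` U)"
  using assms openin_subset[OF assms]
  by (auto simp: openin_end_topology end_open_def end_space_def)

text \<open>Two points of \<open>U\<close> are at distance less than \<open>2\<close>, whereas \<open>\<gamma> t\<close> and \<open>\<gamma> (t + 2)\<close> are at distance
  exactly \<open>2\<close>.\<close>
lemma geodesic_ray_leaves_small_sets: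
  assumes "Metric_space M d" and ray: "geodesic_ray M d \<gamma>"
    and x: "x \<in> M" and U: "U \<subseteq> M" "\<And>y. y \<in> U \<Longrightarrow> d x y < 1"
  shows "\<not> (\<forall>\<^sub>F t in at_top. \<gamma> t \<in> U)"
proof
  interpret Metric_space M d by fact
  assume "\<forall>\<^sub>F t in at_top. \<gamma> t \<in> U"
  then obtain s where s: "\<And>t. t \<ge> s \<Longrightarrow> \<gamma> t \<in> U"
    by (auto simp: eventually_at_top_linorder)
  define t where "t = max s 0"
  have "\<gamma> t \<in> U" "\<gamma> (t + 2) \<in> U" by (auto intro: s simp: t_def)
  then have "d (\<gamma> t) (\<gamma> (t + 2)) < 2"
    using triangle''[of "\<gamma> t" x "\<gamma> (t + 2)"] U x by (smt (verit) in_mono)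
  moreover have "d (\<gamma> t) (\<gamma> (t + 2)) = 2"
    using ray by (simp add: geodesic_ray_def t_def)
  ultimately show False by simp
qed

theorem proposition5p1:
  fixes X :: "'a topology"
    and \<A> :: "('a, 'n::finite) chart set"
    and \<Omega> :: "'a set"
    and K :: "nat \<Rightarrow> 'a set"
    and F :: "('a \<Rightarrow> real) set \<Rightarrow> 'a + (nat \<Rightarrow> 'a set)"
  defines "k \<equiv> kobayashi_dist X \<A> \<Omega>"
    and "\<Omega>bar \<equiv> subtopology X (X closure_of \<Omega>)"
    and "\<Omega>sp \<equiv> subtopology X \<Omega>"
  assumes "complex_manifold X \<A>"
    and "domain_in X \<Omega>"
    and "\<Omega> \<subset> topspace X"
    and "complete_kobayashi_hyperbolic X \<A> \<Omega>"
    and "compact_exhaustion \<Omega>bar K"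
    and "seq_compact_space (end_topology \<Omega>bar K)"
    and "continuous_map (metric_compactification \<Omega>sp k) (end_topology \<Omega>bar K) F"
    and "F ` topspace (metric_compactification \<Omega>sp k) = topspace (end_topology \<Omega>bar K)"
    and "\<And>x. x \<in> \<Omega> \<Longrightarrow> F (metric_embedding \<Omega>sp k x) = Inl x"
  shows "\<forall>\<gamma>. geodesic_ray \<Omega> k \<gamma> \<longrightarrow>
           (\<exists>p \<in> topspace (end_topology \<Omega>bar K) - Inl ` \<Omega>.
              limitin (end_topology \<Omega>bar K) (\<lambda>t. Inl (\<gamma> t)) p at_top)"
proof (intro allI impI)
  fix \<gamma> assume ray: "geodesic_ray \<Omega> k \<gamma>"
  let ?E = "end_topology \<Omega>bar K"
  have open_\<Omega>: "openin X \<Omega>" using \<open>domain_in X \<Omega>\<close> by (simp add: domain_in_def)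
  have sub: "\<Omega> \<subseteq> topspace X" using \<open>\<Omega> \<subset> topspace X\<close> by blast
  have top: "topspace \<Omega>sp = \<Omega>" using sub by (auto simp: \<Omega>sp_def)
  have MS: "Metric_space \<Omega> k"
    using \<open>complete_kobayashi_hyperbolic X \<A> \<Omega>\<close> by (simp add: complete_kobayashi_hyperbolic_def k_def)
  note near = kobayashi_dist_small_near[OF \<open>complex_manifold X \<A>\<close> open_\<Omega>, folded k_def]
  have "\<exists>U. openin \<Omega>sp U \<and> x \<in> U \<and> (\<forall>y\<in>U. k x y < \<epsilon>)" if "x \<in> topspace \<Omega>sp" "\<epsilon> > 0" for x \<epsilon>
    using near[of x \<epsilon>] that top open_\<Omega> by (metis \<Omega>sp_def openin_open_subtopology)
  then obtain \<xi> where "limitin (metric_compactification \<Omega>sp k) (\<lambda>t. metric_embedding \<Omega>sp k (\<gamma> t)) \<xi> at_top"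
    using geodesic_ray_converges_in_metric_compactification[of \<Omega>sp k \<gamma>] MS ray top by auto
  from continuous_map_limit[OF \<open>continuous_map (metric_compactification \<Omega>sp k) ?E F\<close> this]
  have "limitin ?E (\<lambda>t. F (metric_embedding \<Omega>sp k (\<gamma> t))) (F \<xi>) at_top"
    by (simp add: o_def)
  moreover have ev: "\<forall>\<^sub>F t in at_top. F (metric_embedding \<Omega>sp k (\<gamma> t)) = Inl (\<gamma> t)"
    using eventually_ge_at_top[of 0]
    by eventually_elim (use ray assms(12) in \<open>auto simp: geodesic_ray_def\<close>)
  ultimately have lim: "limitin ?E (\<lambda>t. Inl (\<gamma> t)) (F \<xi>) at_top"
    by (intro limitin_transform_eventually[OF ev])
  have "F \<xi> \<notin> Inl ` \<Omega>"
  proof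
    assume "F \<xi> \<in> Inl ` \<Omega>"
    then obtain x where x: "x \<in> \<Omega>" "F \<xi> = Inl x" by blast
    obtain U where U: "openin X U" "x \<in> U" "U \<subseteq> \<Omega>" "\<And>y. y \<in> U \<Longrightarrow> k x y < 1"
      using near[of x 1] x by auto
    have "U \<subseteq> X closure_of \<Omega>" using U(3) closure_of_subset[OF sub] by blast
    then have "openin \<Omega>bar U"
      using U(1) unfolding \<Omega>bar_def by (metis inf.absorb1 openin_subtopology)
    then have "openin ?E (Inl ` U)" by (rule openin_end_topology_Inl)
    from limitinD[OF lim this] have "\<forall>\<^sub>F t in at_top. \<gamma> t \<in> U"
      using x U(2) by (simp add: inj_image_mem_iff)
    then show False
      using geodesic_ray_leaves_small_sets[OF MS ray x(1) U(3,4)] by blast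
  qed
  then show "\<exists>p \<in> topspace ?E - Inl ` \<Omega>. limitin ?E (\<lambda>t. Inl (\<gamma> t)) p at_top"
    using lim limitin_topspace[OF lim] by (intro bexI[of _ "F \<xi>"]) auto
qed

end
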